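(* Let $I=(0,T)$ with $0<T\le\infty$ and let $\alpha\in(0,1)$. Define the transformation $\Phi:(0,T)\to(0,T^\alpha)$ by $\Phi(t)=t^\alpha$. Then the mapping $$U:L^{p,\alpha}(0,T)\longrightarrow L^p(0,T^\alpha),\qquad (Uf)(s)=f\bigl(s^{1/\alpha}\bigr),$$ is an isometric isomorphism.
   Context: Here $1\le p<\infty$. For an interval $I\subset\mathbb R_+$ and $\alpha\in(0,1)$, the conformable Lebesgue space $L^{p,\alpha}(I)$ is the space of measurable functions $f:I\to\mathbb C$ with $\int_I|f(t)|^p\,t^{\alpha-1}\,dt<\infty$, endowed with the norm $\|f\|_{p,\alpha}=\bigl(\int_I|f(t)|^p\,t^{\alpha-1}\,dt\bigr)^{1/p}$. $L^p(0,T^\alpha)$ is the classical Lebesgue space on $(0,T^\alpha)$ (with $T^\alpha=\infty$ if $T=\infty$).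
   Formalization: As stated, U is not isometric: for p=1, T=1, f=1 the norms are 1/α and 1. Proved instead: U is a linear isomorphism with ‖Uf‖_p = α^{1/p}‖f‖_{p,α}, and α^{-1/p}U is an isometric isomorphism. *)

theory Defs
  imports "HOL-Analysis.Analysis"
begin

text \<open>
  The Lebesgue spaces are spaces of classes modulo equality almost everywhere, over the complex
  scalars. Functions are total, but only their values on the space of the measure matter: a class
  identifies functions that agree there, so over \<open>lebesgue_on I\<close> it amounts to a class of functions
  on \<open>I\<close>. The definitions are intended for \<open>p \<ge> 1\<close>.
\<close>

definition Lp_functions :: "real \<Rightarrow> 'a measure \<Rightarrow> ('a \<Rightarrow> complex) set" where
  "Lp_functions p M =
     {f \<in> borel_measurable M. integrable M (\<lambda>x. norm (f x) powr p)}"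

definition Lp_rel :: "real \<Rightarrow> 'a measure \<Rightarrow> (('a \<Rightarrow> complex) \<times> ('a \<Rightarrow> complex)) set" where
  "Lp_rel p M =
     {(f, g). f \<in> Lp_functions p M \<and> g \<in> Lp_functions p M \<and> (AE x in M. f x = g x)}"

definition Lp_space :: "real \<Rightarrow> 'a measure \<Rightarrow> ('a \<Rightarrow> complex) set set" where
  "Lp_space p M = Lp_functions p M // Lp_rel p M"

definition Lp_class :: "real \<Rightarrow> 'a measure \<Rightarrow> ('a \<Rightarrow> complex) \<Rightarrow> ('a \<Rightarrow> complex) set" where
  "Lp_class p M f = Lp_rel p M `` {f}"

definition Lp_rep :: "('a \<Rightarrow> complex) set \<Rightarrow> 'a \<Rightarrow> complex" where
  "Lp_rep F = (SOME f. f \<in> F)"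

definition Lp_add ::
  "real \<Rightarrow> 'a measure \<Rightarrow> ('a \<Rightarrow> complex) set \<Rightarrow> ('a \<Rightarrow> complex) set \<Rightarrow> ('a \<Rightarrow> complex) set" where
  "Lp_add p M F G = Lp_class p M (\<lambda>x. Lp_rep F x + Lp_rep G x)"

definition Lp_scale ::
  "real \<Rightarrow> 'a measure \<Rightarrow> complex \<Rightarrow> ('a \<Rightarrow> complex) set \<Rightarrow> ('a \<Rightarrow> complex) set" where
  "Lp_scale p M c F = Lp_class p M (\<lambda>x. c * Lp_rep F x)"

definition Lp_norm :: "real \<Rightarrow> 'a measure \<Rightarrow> ('a \<Rightarrow> complex) set \<Rightarrow> real" where
  "Lp_norm p M F = (\<integral>x. norm (Lp_rep F x) powr p \<partial>M) powr (1 / p)"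

definition Lp_linear_isomorphism ::
  "real \<Rightarrow> 'a measure \<Rightarrow> 'b measure \<Rightarrow> (('a \<Rightarrow> complex) set \<Rightarrow> ('b \<Rightarrow> complex) set) \<Rightarrow> bool" where
  "Lp_linear_isomorphism p M N V \<longleftrightarrow>
     bij_betw V (Lp_space p M) (Lp_space p N) \<and>
     (\<forall>F\<in>Lp_space p M. \<forall>G\<in>Lp_space p M. V (Lp_add p M F G) = Lp_add p N (V F) (V G)) \<and>
     (\<forall>c. \<forall>F\<in>Lp_space p M. V (Lp_scale p M c F) = Lp_scale p N c (V F))"

definition Lp_isometric_isomorphism ::
  "real \<Rightarrow> 'a measure \<Rightarrow> 'b measure \<Rightarrow> (('a \<Rightarrow> complex) set \<Rightarrow> ('b \<Rightarrow> complex) set) \<Rightarrow> bool" where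
  "Lp_isometric_isomorphism p M N V \<longleftrightarrow>
     Lp_linear_isomorphism p M N V \<and>
     (\<forall>F\<in>Lp_space p M. Lp_norm p N (V F) = Lp_norm p M F)"

text \<open>
  The measure \<open>t\<^sup>\<alpha>\<^sup>-\<^sup>1 dt\<close> on \<open>I \<subseteq> [0, \<infinity>)\<close>; the conformable Lebesgue space of exponents \<open>p\<close> and \<open>\<alpha>\<close>
  on \<open>I\<close> is \<open>Lp_space p (conformable_measure \<alpha> I)\<close>.
\<close>

definition conformable_measure :: "real \<Rightarrow> real set \<Rightarrow> real measure" where
  "conformable_measure \<alpha> I = density (lebesgue_on I) (\<lambda>t. ennreal (t powr (\<alpha> - 1)))"

definition ereal_rpow :: "ereal \<Rightarrow> real \<Rightarrow> ereal" where
  "ereal_rpow T \<alpha> = (if T = \<infinity> then \<infinity> else ereal (real_of_ereal T powr \<alpha>))"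

abbreviation source_measure :: "real \<Rightarrow> ereal \<Rightarrow> real measure" where
  "source_measure \<alpha> T \<equiv> conformable_measure \<alpha> (einterval 0 T)"

abbreviation target_measure :: "real \<Rightarrow> ereal \<Rightarrow> real measure" where
  "target_measure \<alpha> T \<equiv> lebesgue_on (einterval 0 (ereal_rpow T \<alpha>))"

definition conformable_Phi :: "real \<Rightarrow> real \<Rightarrow> real" where
  "conformable_Phi \<alpha> t = t powr \<alpha>"

definition conformable_U_fun :: "real \<Rightarrow> (real \<Rightarrow> complex) \<Rightarrow> real \<Rightarrow> complex" where
  "conformable_U_fun \<alpha> f = (\<lambda>s. f (s powr (1 / \<alpha>)))"

definition conformable_U ::
  "real \<Rightarrow> real \<Rightarrow> ereal \<Rightarrow> (real \<Rightarrow> complex) set \<Rightarrow> (real \<Rightarrow> complex) set" where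
  "conformable_U p \<alpha> T F =
     Lp_class p (target_measure \<alpha> T) (conformable_U_fun \<alpha> (Lp_rep F))"

text \<open>
  Since \<open>d(t\<^sup>\<alpha>) = \<alpha> t\<^sup>\<alpha>\<^sup>-\<^sup>1 dt\<close>, composition with \<open>s \<mapsto> s\<^sup>1\<^sup>/\<^sup>\<alpha>\<close> multiplies the norm by \<open>\<alpha> powr (1 / p)\<close>,
  which is less than 1 for \<open>0 < \<alpha> < 1\<close>. The operator below is rescaled by the inverse factor.
\<close>

definition conformable_U_normalized ::
  "real \<Rightarrow> real \<Rightarrow> ereal \<Rightarrow> (real \<Rightarrow> complex) set \<Rightarrow> (real \<Rightarrow> complex) set" where
  "conformable_U_normalized p \<alpha> T F =
     Lp_scale p (target_measure \<alpha> T) (of_real (\<alpha> powr (- 1 / p))) (conformable_U p \<alpha> T F)"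

end

theory Submission
  imports Defs
begin

text \<open>
  The substitution \<open>s = t powr \<alpha>\<close> shows that the image of Lebesgue measure on \<open>(0, T\<^sup>\<alpha>)\<close> under
  \<open>s \<mapsto> s powr (1 / \<alpha>)\<close> is \<open>\<alpha>\<close> times the measure \<open>t powr (\<alpha> - 1) dt\<close> on \<open>(0, T)\<close>. Composition with
  a measurable map that has a measurable right inverse and carries one measure to \<open>a\<close> times another
  one is a bijective linear map of the \<open>L\<^sup>p\<close> spaces that multiplies the norm by \<open>a powr (1 / p)\<close>.
\<close>

section \<open>Classes of functions modulo equality almost everywhere\<close>

lemma Lp_functionsD:
  assumes "f \<in> Lp_functions p M"
  shows "f \<in> borel_measurable M" "integrable M (\<lambda>x. norm (f x) powr p)"
  using assms by (auto simp: Lp_functions_def)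

lemma equiv_Lp_rel: "equiv (Lp_functions p M) (Lp_rel p M)"
  by (rule equivI) (auto simp: Lp_rel_def refl_on_def sym_def trans_def)

lemma Lp_class_eq_iff:
  assumes "f \<in> Lp_functions p M" "g \<in> Lp_functions p M"
  shows "Lp_class p M f = Lp_class p M g \<longleftrightarrow> (AE x in M. f x = g x)"
  using eq_equiv_class_iff[OF equiv_Lp_rel assms] assms
  by (simp add: Lp_class_def Lp_rel_def)

lemma Lp_class_in_space: "f \<in> Lp_functions p M \<Longrightarrow> Lp_class p M f \<in> Lp_space p M"
  by (simp add: Lp_class_def Lp_space_def quotientI)

lemma Lp_spaceE:
  assumes "F \<in> Lp_space p M"
  obtains f where "f \<in> Lp_functions p M" "F = Lp_class p M f"
  using assms by (auto simp: Lp_class_def Lp_space_def elim: quotientE)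

text \<open>Makes the choice hidden in \<open>Lp_rep\<close> harmless: the chosen function may
  differ from \<open>f\<close>, but only on a null set.\<close>

lemma Lp_rep_class:
  assumes "f \<in> Lp_functions p M"
  shows "Lp_rep (Lp_class p M f) \<in> Lp_functions p M" "AE x in M. Lp_rep (Lp_class p M f) x = f x"
proof -
  have "f \<in> Lp_class p M f"
    using assms by (simp add: Lp_class_def Lp_rel_def)
  then have "Lp_rep (Lp_class p M f) \<in> Lp_class p M f"
    unfolding Lp_rep_def by (rule someI[of "\<lambda>g. g \<in> Lp_class p M f"])
  then show "Lp_rep (Lp_class p M f) \<in> Lp_functions p M" "AE x in M. Lp_rep (Lp_class p M f) x = f x"
    by (auto simp: Lp_class_def Lp_rel_def elim: AE_mp)
qed

text \<open>The sum has norm at most twice the larger of the two norms, and the p-th power of the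
  larger one is a summand on the right. This crude bound serves as the dominating function for
  closure under addition.\<close>

lemma powr_norm_add_le:
  fixes x y :: "'a :: real_normed_vector"
  assumes "0 \<le> p"
  shows "norm (x + y) powr p \<le> 2 powr p * (norm x powr p + norm y powr p)"
proof -
  define m where "m = max (norm x) (norm y)"
  have "norm (x + y) \<le> 2 * m"
    using norm_triangle_ineq[of x y] by (simp add: m_def)
  then have "norm (x + y) powr p \<le> (2 * m) powr p"
    using assms by (intro powr_mono2) auto
  also have "\<dots> = 2 powr p * m powr p"
    by (rule powr_mult)
  also have "m powr p \<le> norm x powr p + norm y powr p"
    unfolding m_def by (cases "norm x \<le> norm y") (simp_all add: max_absorb1 max_absorb2)
  finally show ?thesis
    by simp
qed

lemma Lp_functions_add:
  assumes "0 \<le> p" "f \<in> Lp_functions p M" "g \<in> Lp_functions p M"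
  shows "(\<lambda>x. f x + g x) \<in> Lp_functions p M"
proof -
  note [measurable] = Lp_functionsD(1)[OF assms(2)] Lp_functionsD(1)[OF assms(3)]
  have "integrable M (\<lambda>x. 2 powr p * (norm (f x) powr p + norm (g x) powr p))"
    using assms by (auto dest: Lp_functionsD)
  then have "integrable M (\<lambda>x. norm (f x + g x) powr p)"
    by (rule Bochner_Integration.integrable_bound) (use assms(1) powr_norm_add_le in auto)
  then show ?thesis
    by (simp add: Lp_functions_def)
qed

lemma Lp_functions_scale:
  assumes "f \<in> Lp_functions p M"
  shows "(\<lambda>x. c * f x) \<in> Lp_functions p M"
  using assms by (auto simp: Lp_functions_def norm_mult powr_mult)

text \<open>With its analogues for scaling and the norm, this lets every later identity between
  classes be checked on freely chosen representatives.\<close>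

lemma Lp_add_class:
  assumes "0 \<le> p" "f \<in> Lp_functions p M" "g \<in> Lp_functions p M"
  shows "Lp_add p M (Lp_class p M f) (Lp_class p M g) = Lp_class p M (\<lambda>x. f x + g x)"
  unfolding Lp_add_def
proof (subst Lp_class_eq_iff)
  show "AE x in M. Lp_rep (Lp_class p M f) x + Lp_rep (Lp_class p M g) x = f x + g x"
    using Lp_rep_class(2)[OF assms(2)] Lp_rep_class(2)[OF assms(3)] by eventually_elim simp
qed (use assms in \<open>auto intro!: Lp_functions_add Lp_rep_class\<close>)

lemma Lp_scale_class:
  assumes "f \<in> Lp_functions p M"
  shows "Lp_scale p M c (Lp_class p M f) = Lp_class p M (\<lambda>x. c * f x)"
  unfolding Lp_scale_def
proof (subst Lp_class_eq_iff)
  show "AE x in M. c * Lp_rep (Lp_class p M f) x = c * f x"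
    using Lp_rep_class(2)[OF assms] by eventually_elim simp
qed (use assms in \<open>auto intro!: Lp_functions_scale Lp_rep_class\<close>)

lemma Lp_norm_class:
  assumes "f \<in> Lp_functions p M"
  shows "Lp_norm p M (Lp_class p M f) = (\<integral>x. norm (f x) powr p \<partial>M) powr (1 / p)"
proof -
  note [measurable] = Lp_functionsD(1)[OF assms] Lp_functionsD(1)[OF Lp_rep_class(1)[OF assms]]
  have "(\<integral>x. norm (Lp_rep (Lp_class p M f) x) powr p \<partial>M) = (\<integral>x. norm (f x) powr p \<partial>M)"
    by (rule integral_cong_AE) (use Lp_rep_class(2)[OF assms] in \<open>auto elim: AE_mp\<close>)
  then show ?thesis
    by (simp add: Lp_norm_def)
qed

lemma Lp_norm_scale:
  assumes "0 < p" "F \<in> Lp_space p M"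
  shows "Lp_norm p M (Lp_scale p M c F) = norm c * Lp_norm p M F"
proof -
  from assms(2) obtain f where f: "f \<in> Lp_functions p M" "F = Lp_class p M f"
    by (rule Lp_spaceE)
  \<comment> \<open>This covers \<open>c = 0\<close> too, since \<open>0 powr r = 0\<close>.\<close>
  have "(norm c powr p) powr (1 / p) = norm c"
    using assms(1) by (simp add: powr_powr)
  then show ?thesis
    using f by (simp add: Lp_scale_class Lp_norm_class Lp_functions_scale norm_mult powr_mult
        del: powr_powr)
qed

section \<open>Linear isomorphisms: scaling and composition\<close>

lemma Lp_linear_isomorphism_scale:
  assumes "0 \<le> p" "c \<noteq> 0"
  shows "Lp_linear_isomorphism p M M (Lp_scale p M c)"
  unfolding Lp_linear_isomorphism_def
proof (intro conjI ballI allI)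
  have "Lp_scale p M c F \<in> Lp_space p M" if "F \<in> Lp_space p M" for c F
    using that by (auto elim!: Lp_spaceE simp: Lp_scale_class intro!: Lp_class_in_space Lp_functions_scale)
  \<comment> \<open>Stated for any pair with product 1, so that it gives both composites with the
    witness \<open>inverse c\<close>.\<close>
  moreover have "Lp_scale p M c (Lp_scale p M d F) = F" if "F \<in> Lp_space p M" "c * d = 1" for c d F
  proof -
    have *: "c * (d * z) = z" for z
      using that(2) by (simp flip: mult.assoc)
    from that(1) show ?thesis
      by (auto elim!: Lp_spaceE simp: Lp_scale_class Lp_functions_scale *)
  qed
  ultimately show "bij_betw (Lp_scale p M c) (Lp_space p M) (Lp_space p M)"
    using assms(2) by (intro bij_betw_byWitness[where f' = "Lp_scale p M (inverse c)"]) auto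
next
  fix F G assume "F \<in> Lp_space p M" "G \<in> Lp_space p M"
  then show "Lp_scale p M c (Lp_add p M F G) = Lp_add p M (Lp_scale p M c F) (Lp_scale p M c G)"
    using assms(1)
    by (auto elim!: Lp_spaceE simp: Lp_scale_class Lp_add_class Lp_functions_scale Lp_functions_add
        distrib_left)
next
  fix d F assume "F \<in> Lp_space p M"
  then show "Lp_scale p M c (Lp_scale p M d F) = Lp_scale p M d (Lp_scale p M c F)"
    by (auto elim!: Lp_spaceE simp: Lp_scale_class Lp_functions_scale mult.left_commute)
qed

lemma Lp_linear_isomorphism_compose:
  assumes "Lp_linear_isomorphism p M N V" "Lp_linear_isomorphism p N K W"
  shows "Lp_linear_isomorphism p M K (\<lambda>F. W (V F))"
proof -
  have V: "bij_betw V (Lp_space p M) (Lp_space p N)" and W: "bij_betw W (Lp_space p N) (Lp_space p K)"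
    using assms by (auto simp: Lp_linear_isomorphism_def)
  have "V F \<in> Lp_space p N" if "F \<in> Lp_space p M" for F
    using V that by (auto simp: bij_betw_def)
  moreover have "bij_betw (\<lambda>F. W (V F)) (Lp_space p M) (Lp_space p K)"
    using bij_betw_trans[OF V W] by (simp add: comp_def)
  ultimately show ?thesis
    using assms by (auto simp: Lp_linear_isomorphism_def)
qed

section \<open>Composition with a map that rescales the measure\<close>

text \<open>The operator studied is f \<mapsto> f \<circ> \<psi>. The equation
  \<open>distr_\<psi>\<close> controls null sets and integrals, hence injectivity and the norm.
  Since \<phi> is a left inverse of \<psi> on \<open>space N\<close>, g \<circ> \<phi> is a preimage
  of g, hence surjectivity.\<close>

locale measure_rescaling =
  fixes M :: "'a measure" and N :: "'b measure"
    and \<phi> :: "'a \<Rightarrow> 'b" and \<psi> :: "'b \<Rightarrow> 'a" and a :: real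
  assumes measurable_\<phi> [measurable]: "\<phi> \<in> M \<rightarrow>\<^sub>M N"
    and measurable_\<psi> [measurable]: "\<psi> \<in> N \<rightarrow>\<^sub>M M"
    and \<phi>_\<psi>: "\<And>s. s \<in> space N \<Longrightarrow> \<phi> (\<psi> s) = s"
    and a_pos: "0 < a"
    and distr_\<psi>: "distr N M \<psi> = density M (\<lambda>_. ennreal a)"
begin

text \<open>By \<open>distr_\<psi>\<close> the left side is a statement about M with the constant
  density \<open>a\<close>, and a positive constant density keeps the null sets.\<close>

lemma AE_comp_iff:
  assumes "{t \<in> space M. P t} \<in> sets M"
  shows "(AE s in N. P (\<psi> s)) \<longleftrightarrow> (AE t in M. P t)"
proof -
  have "(AE s in N. P (\<psi> s)) \<longleftrightarrow> (AE t in distr N M \<psi>. P t)"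
    using assms by (simp add: AE_distr_iff)
  also have "\<dots> \<longleftrightarrow> (AE t in M. P t)"
    unfolding distr_\<psi> using a_pos by (subst AE_density) auto
  finally show ?thesis .
qed

text \<open>From left to right this is what puts preimages into the space of M in the proof of
  surjectivity; from right to left it shows that composition lands in the space of N.\<close>

lemma integrable_comp_iff:
  fixes f :: "'a \<Rightarrow> real"
  assumes [measurable]: "f \<in> borel_measurable M"
  shows "integrable N (\<lambda>s. f (\<psi> s)) \<longleftrightarrow> integrable M f"
proof -
  have "integrable N (\<lambda>s. f (\<psi> s)) \<longleftrightarrow> integrable (density M (\<lambda>_. ennreal a)) f"
    by (simp add: integrable_distr_eq flip: distr_\<psi>)
  also have "\<dots> \<longleftrightarrow> integrable M f"
    using a_pos by (simp add: integrable_density)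
  finally show ?thesis .
qed

lemma integral_comp:
  fixes f :: "'a \<Rightarrow> real"
  assumes [measurable]: "f \<in> borel_measurable M"
  shows "(\<integral>s. f (\<psi> s) \<partial>N) = a * (\<integral>t. f t \<partial>M)"
proof -
  have "(\<integral>s. f (\<psi> s) \<partial>N) = (\<integral>t. f t \<partial>density M (\<lambda>_. ennreal a))"
    by (simp add: integral_distr flip: distr_\<psi>)
  also have "\<dots> = a * (\<integral>t. f t \<partial>M)"
    using a_pos by (simp add: integral_density)
  finally show ?thesis .
qed

lemma Lp_functions_comp:
  assumes "f \<in> Lp_functions p M"
  shows "(\<lambda>s. f (\<psi> s)) \<in> Lp_functions p N"
proof -
  note [measurable] = Lp_functionsD(1)[OF assms]
  show ?thesis
    using integrable_comp_iff[of "\<lambda>t. norm (f t) powr p"] Lp_functionsD(2)[OF assms]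
    by (simp add: Lp_functions_def)
qed

text \<open>One direction says that composition is well defined on classes, the other that it is
  injective there. Both come from the correspondence of null sets.\<close>

lemma Lp_class_comp_eq_iff:
  assumes f: "f \<in> Lp_functions p M" and g: "g \<in> Lp_functions p M"
  shows "Lp_class p N (\<lambda>s. f (\<psi> s)) = Lp_class p N (\<lambda>s. g (\<psi> s)) \<longleftrightarrow>
    Lp_class p M f = Lp_class p M g"
proof -
  note [measurable] = Lp_functionsD(1)[OF f] Lp_functionsD(1)[OF g]
  have "{t \<in> space M. f t = g t} \<in> sets M"
    by measurable
  then show ?thesis
    using AE_comp_iff[of "\<lambda>t. f t = g t"] f g by (simp add: Lp_class_eq_iff Lp_functions_comp)
qed

definition comp_class :: "real \<Rightarrow> ('a \<Rightarrow> complex) set \<Rightarrow> ('b \<Rightarrow> complex) set" where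
  "comp_class p F = Lp_class p N (\<lambda>s. Lp_rep F (\<psi> s))"

lemma comp_class_Lp_class:
  assumes "f \<in> Lp_functions p M"
  shows "comp_class p (Lp_class p M f) = Lp_class p N (\<lambda>s. f (\<psi> s))"
proof -
  have "Lp_class p M (Lp_rep (Lp_class p M f)) = Lp_class p M f"
    using Lp_rep_class[OF assms] assms by (simp add: Lp_class_eq_iff)
  then show ?thesis
    using Lp_rep_class(1)[OF assms] assms by (simp add: comp_class_def Lp_class_comp_eq_iff)
qed

text \<open>The preimage of the class of g is the class of g \<circ> \<phi>, because g \<circ>
  \<phi> \<circ> \<psi> = g on \<open>space N\<close>.\<close>

lemma comp_class_surj:
  assumes "G \<in> Lp_space p N"
  shows "G \<in> comp_class p ` Lp_space p M"
proof -
  from assms obtain g where g: "g \<in> Lp_functions p N" and G: "G = Lp_class p N g"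
    by (rule Lp_spaceE)
  note [measurable] = Lp_functionsD(1)[OF g]
  have "integrable N (\<lambda>s. norm (g (\<phi> (\<psi> s))) powr p) \<longleftrightarrow> integrable N (\<lambda>s. norm (g s) powr p)"
    by (intro Bochner_Integration.integrable_cong) (simp_all add: \<phi>_\<psi>)
  then have f: "(\<lambda>t. g (\<phi> t)) \<in> Lp_functions p M"
    using Lp_functionsD(2)[OF g] integrable_comp_iff[of "\<lambda>t. norm (g (\<phi> t)) powr p"]
    by (simp add: Lp_functions_def)
  have "AE s in N. g s = g (\<phi> (\<psi> s))"
    by (intro AE_I2) (simp add: \<phi>_\<psi>)
  then have "G = comp_class p (Lp_class p M (\<lambda>t. g (\<phi> t)))"
    using Lp_functions_comp[OF f] f g by (simp add: G comp_class_Lp_class Lp_class_eq_iff)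
  then show ?thesis
    using Lp_class_in_space[OF f] by blast
qed

lemma Lp_linear_isomorphism_comp_class:
  assumes "0 \<le> p"
  shows "Lp_linear_isomorphism p M N (comp_class p)"
  unfolding Lp_linear_isomorphism_def
proof (intro conjI ballI allI)
  have "inj_on (comp_class p) (Lp_space p M)"
    by (auto intro!: inj_onI elim!: Lp_spaceE simp: comp_class_Lp_class Lp_class_comp_eq_iff)
  moreover have "comp_class p ` Lp_space p M \<subseteq> Lp_space p N"
    by (auto elim!: Lp_spaceE simp: comp_class_Lp_class intro!: Lp_class_in_space Lp_functions_comp)
  ultimately show "bij_betw (comp_class p) (Lp_space p M) (Lp_space p N)"
    using comp_class_surj by (auto simp: bij_betw_def)
next
  fix F G assume "F \<in> Lp_space p M" "G \<in> Lp_space p M"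
  then show "comp_class p (Lp_add p M F G) = Lp_add p N (comp_class p F) (comp_class p G)"
    using assms
    by (auto elim!: Lp_spaceE
        simp: comp_class_Lp_class Lp_add_class Lp_functions_add Lp_functions_comp)
next
  fix c F assume "F \<in> Lp_space p M"
  then show "comp_class p (Lp_scale p M c F) = Lp_scale p N c (comp_class p F)"
    by (auto elim!: Lp_spaceE
        simp: comp_class_Lp_class Lp_scale_class Lp_functions_scale Lp_functions_comp)
qed

text \<open>The integral of the p-th power picks up the factor \<open>a\<close>, of which the norm
  takes the p-th root.\<close>

lemma Lp_norm_comp_class:
  assumes "F \<in> Lp_space p M"
  shows "Lp_norm p N (comp_class p F) = a powr (1 / p) * Lp_norm p M F"
proof -
  from assms obtain f where f: "f \<in> Lp_functions p M" and F: "F = Lp_class p M f"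
    by (rule Lp_spaceE)
  note [measurable] = Lp_functionsD(1)[OF f]
  show ?thesis
    using f a_pos integral_comp[of "\<lambda>t. norm (f t) powr p"]
    by (simp add: F comp_class_Lp_class Lp_norm_class Lp_functions_comp powr_mult)
qed

lemma Lp_isometric_isomorphism_comp_class:
  assumes "0 < p"
  shows "Lp_isometric_isomorphism p M N
    (\<lambda>F. Lp_scale p N (of_real (a powr (- 1 / p))) (comp_class p F))"
  unfolding Lp_isometric_isomorphism_def
proof (intro conjI ballI)
  show "Lp_linear_isomorphism p M N
      (\<lambda>F. Lp_scale p N (of_real (a powr (- 1 / p))) (comp_class p F))"
    using assms a_pos
    by (intro Lp_linear_isomorphism_compose[OF Lp_linear_isomorphism_comp_class]
        Lp_linear_isomorphism_scale) auto
  fix F assume F: "F \<in> Lp_space p M"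
  then have "comp_class p F \<in> Lp_space p N"
    using Lp_linear_isomorphism_comp_class[of p] assms
    by (auto simp: Lp_linear_isomorphism_def bij_betw_def)
  moreover have "a powr (- 1 / p) * a powr (1 / p) = 1"
    using a_pos by (simp flip: powr_add)
  ultimately show "Lp_norm p N (Lp_scale p N (of_real (a powr (- 1 / p))) (comp_class p F)) =
      Lp_norm p M F"
    using F assms by (simp add: Lp_norm_scale Lp_norm_comp_class flip: mult.assoc)
qed

end

section \<open>The power substitution\<close>

text \<open>Change of variables for the constant function 1. The formula applied concerns absolutely
  integrable functions, so images of infinite measure are treated as a separate case.\<close>

lemma emeasure_differentiable_image:
  fixes g h :: "real \<Rightarrow> real"
  assumes A: "A \<in> sets lebesgue"
    and g: "\<And>x. x \<in> A \<Longrightarrow> (g has_field_derivative h x) (at x within A)"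
    and inj: "inj_on g A"
    and h: "h \<in> borel_measurable (lebesgue_on A)"
  shows "g ` A \<in> sets lebesgue"
    and "emeasure lebesgue (g ` A) = (\<integral>\<^sup>+x. ennreal \<bar>h x\<bar> \<partial>lebesgue_on A)"
proof -
  have "g differentiable_on A"
    using g by (meson differentiable_on_def has_field_derivative_imp_has_derivative differentiable_def)
  then show gA: "g ` A \<in> sets lebesgue"
    using A by (intro differentiable_image_in_sets_lebesgue) auto
  \<comment> \<open>Leaving \<open>b\<close> free yields both the equality of the integrals and,
    with \<open>b\<close> taken to be an actual integral, the equivalence of integrability.\<close>
  have subst: "(\<lambda>x. \<bar>h x\<bar>) absolutely_integrable_on A \<and> integral A (\<lambda>x. \<bar>h x\<bar>) = b \<longleftrightarrow>
      (\<lambda>_. 1 :: real) absolutely_integrable_on g ` A \<and> integral (g ` A) (\<lambda>_. 1 :: real) = b" for b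
    using has_absolute_integral_change_of_variables_1'[OF A g inj, of "\<lambda>_. 1" b] by simp
  have abs_iff: "(\<lambda>x. \<bar>h x\<bar>) absolutely_integrable_on A \<longleftrightarrow> integrable (lebesgue_on A) (\<lambda>x. \<bar>h x\<bar>)"
    using A by (simp add: set_integrable_def integrable_restrict_space)
  have one_iff: "(\<lambda>_. 1 :: real) absolutely_integrable_on g ` A \<longleftrightarrow> g ` A \<in> lmeasurable"
    by (simp add: lmeasurable_iff_integrable set_integrable_def)
  show "emeasure lebesgue (g ` A) = (\<integral>\<^sup>+x. ennreal \<bar>h x\<bar> \<partial>lebesgue_on A)"
  proof (cases "g ` A \<in> lmeasurable")
    case True
    then have int: "(\<lambda>x. \<bar>h x\<bar>) absolutely_integrable_on A"
      and eq: "integral A (\<lambda>x. \<bar>h x\<bar>) = measure lebesgue (g ` A)"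
      using subst[of "measure lebesgue (g ` A)"] by (auto simp: one_iff lmeasure_integral)
    have "(\<integral>\<^sup>+x. ennreal \<bar>h x\<bar> \<partial>lebesgue_on A) = ennreal (\<integral>x. \<bar>h x\<bar> \<partial>lebesgue_on A)"
      using int by (intro nn_integral_eq_integral) (auto simp: abs_iff)
    also have "(\<integral>x. \<bar>h x\<bar> \<partial>lebesgue_on A) = integral A (\<lambda>x. \<bar>h x\<bar>)"
      using int A by (intro lebesgue_integral_eq_integral) (auto simp: abs_iff)
    finally show ?thesis
      using True eq by (simp add: emeasure_eq_measure2)
  next
    case False
    \<comment> \<open>Both functions are measurable and nonnegative, so failure of integrability on
      either side means the value \<infinity>.\<close>
    then have "\<not> integrable (lebesgue_on A) (\<lambda>x. \<bar>h x\<bar>)"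
      using subst abs_iff one_iff by blast
    then have "(\<integral>\<^sup>+x. ennreal \<bar>h x\<bar> \<partial>lebesgue_on A) = \<infinity>"
      using h by (auto simp: integrable_iff_bounded not_less top_unique)
    moreover have "emeasure lebesgue (g ` A) = \<infinity>"
      using False gA by (auto simp: fmeasurable_def not_less top_unique)
    ultimately show ?thesis
      by simp
  qed
qed

lemma einterval_0_powr_image:
  fixes T :: ereal
  assumes "0 < \<alpha>" "0 < T"
  shows "(\<lambda>t. t powr \<alpha>) ` einterval 0 T = einterval 0 (ereal_rpow T \<alpha>)"
    and "(\<lambda>s. s powr (1 / \<alpha>)) ` einterval 0 (ereal_rpow T \<alpha>) = einterval 0 T"
proof -
  have 1: "t powr \<alpha> \<in> einterval 0 (ereal_rpow T \<alpha>)" if "t \<in> einterval 0 T" for t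
    using that assms by (cases T) (auto simp: einterval_def ereal_rpow_def intro: powr_less_mono2)
  have 2: "s powr (1 / \<alpha>) \<in> einterval 0 T" if "s \<in> einterval 0 (ereal_rpow T \<alpha>)" for s
  \<comment> \<open>Only a finite right endpoint calls for comparing powers; for T = \<infinity>
    positivity suffices, and T = -\<infinity> contradicts \<open>0 < T\<close>.\<close>
  proof (cases T)
    case (real r)
    with that assms have "0 < s" "s < r powr \<alpha>" "0 < r"
      by (auto simp: einterval_def ereal_rpow_def)
    then have "s powr (1 / \<alpha>) < (r powr \<alpha>) powr (1 / \<alpha>)"
      using assms by (intro powr_less_mono2) auto
    with \<open>0 < s\<close> \<open>0 < r\<close> assms show ?thesis
      by (simp add: real einterval_def powr_powr)
  qed (use that assms in \<open>auto simp: einterval_def ereal_rpow_def\<close>)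
  \<comment> \<open>The right endpoint \<open>S\<close> is arbitrary so that the fact applies to the
    source and to the target interval.\<close>
  have 3: "(t powr \<alpha>) powr (1 / \<alpha>) = t" "(t powr (1 / \<alpha>)) powr \<alpha> = t"
    if "t \<in> einterval 0 S" for t S
    using that assms by (auto simp: einterval_def powr_powr)
  show "(\<lambda>t. t powr \<alpha>) ` einterval 0 T = einterval 0 (ereal_rpow T \<alpha>)"
    using 1 2 3 by (auto intro!: image_eqI[of _ _ "_ powr (1 / \<alpha>)"])
  show "(\<lambda>s. s powr (1 / \<alpha>)) ` einterval 0 (ereal_rpow T \<alpha>) = einterval 0 T"
    using 1 2 3 by (auto intro!: image_eqI[of _ _ "_ powr \<alpha>"])
qed

text \<open>On the positive half-line the power map is differentiable, and the power with exponent
  \<open>1 / \<beta>\<close> inverts it, so the preceding change of variables applies.\<close>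

lemma emeasure_powr_image:
  assumes A: "A \<in> sets lebesgue" and pos: "A \<subseteq> {0<..}" and "\<beta> \<noteq> 0"
  shows "(\<lambda>t. t powr \<beta>) ` A \<in> sets lebesgue"
    and "emeasure lebesgue ((\<lambda>t. t powr \<beta>) ` A) =
      (\<integral>\<^sup>+t. ennreal \<bar>\<beta> * t powr (\<beta> - 1)\<bar> \<partial>lebesgue_on A)"
proof -
  have deriv: "((\<lambda>t. t powr \<beta>) has_field_derivative \<beta> * t powr (\<beta> - 1)) (at t within A)" if "t \<in> A" for t
    using that pos by (intro DERIV_subset[OF has_real_derivative_powr]) auto
  have inj: "inj_on (\<lambda>t. t powr \<beta>) A"
  proof (rule inj_on_inverseI)
    fix t assume "t \<in> A"
    then show "(t powr \<beta>) powr (1 / \<beta>) = t"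
      using pos \<open>\<beta> \<noteq> 0\<close> by (auto simp: powr_powr)
  qed
  have meas: "(\<lambda>t. \<beta> * t powr (\<beta> - 1)) \<in> borel_measurable (lebesgue_on A)"
    by (intro measurable_restrict_space1 measurable_completion) simp
  show "(\<lambda>t. t powr \<beta>) ` A \<in> sets lebesgue"
    by (rule emeasure_differentiable_image(1)[OF A deriv inj meas])
  show "emeasure lebesgue ((\<lambda>t. t powr \<beta>) ` A) =
      (\<integral>\<^sup>+t. ennreal \<bar>\<beta> * t powr (\<beta> - 1)\<bar> \<partial>lebesgue_on A)"
    by (rule emeasure_differentiable_image(2)[OF A deriv inj meas])
qed

text \<open>Continuity is not enough here, since preimages of Lebesgue sets under continuous maps
  may fail to be Lebesgue measurable. The preimage is instead written as an image under the inverse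
  power, and differentiable images of Lebesgue sets are Lebesgue sets.\<close>

lemma measurable_powr_lebesgue_on:
  fixes \<beta> :: real
  assumes "I \<in> sets lebesgue" "J \<in> sets lebesgue" "J \<subseteq> {0<..}" "\<beta> \<noteq> 0"
    and I: "I = (\<lambda>s. s powr \<beta>) ` J"
  shows "(\<lambda>s. s powr \<beta>) \<in> lebesgue_on J \<rightarrow>\<^sub>M lebesgue_on I"
proof (rule measurableI)
  fix A assume "A \<in> sets (lebesgue_on I)"
  with assms(1) have A: "A \<in> sets lebesgue" "A \<subseteq> I"
    by (auto simp: sets_restrict_space_iff)
  have inv: "(s powr \<beta>) powr (1 / \<beta>) = s" if "s \<in> J" for s
    using that assms(3,4) by (auto simp: powr_powr)
  have eq: "(\<lambda>s. s powr \<beta>) -` A \<inter> J = (\<lambda>t. t powr (1 / \<beta>)) ` A"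
  proof (intro equalityI subsetI)
    fix s assume "s \<in> (\<lambda>s. s powr \<beta>) -` A \<inter> J"
    then show "s \<in> (\<lambda>t. t powr (1 / \<beta>)) ` A"
      using inv[of s] by (intro image_eqI[of _ _ "s powr \<beta>"]) auto
  next
    fix s assume "s \<in> (\<lambda>t. t powr (1 / \<beta>)) ` A"
    then obtain r where "r \<in> J" "r powr \<beta> \<in> A" "s = (r powr \<beta>) powr (1 / \<beta>)"
      using A(2) I by auto
    then show "s \<in> (\<lambda>s. s powr \<beta>) -` A \<inter> J"
      using inv by auto
  qed
  have "A \<subseteq> {0<..}"
    using A(2) assms(3) unfolding I by fastforce
  then have "(\<lambda>s. s powr \<beta>) -` A \<inter> J \<in> sets lebesgue"
    unfolding eq using A(1) assms(4) by (intro emeasure_powr_image(1)) auto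
  then show "(\<lambda>s. s powr \<beta>) -` A \<inter> space (lebesgue_on J) \<in> sets (lebesgue_on J)"
    using assms(2)
    by (simp add: sets_restrict_space_iff)
qed (use I in auto)

section \<open>The conformable measure as a rescaled image of Lebesgue measure\<close>

lemma sets_conformable_measure: "sets (conformable_measure \<alpha> I) = sets (lebesgue_on I)"
  by (simp add: conformable_measure_def)

lemma measure_rescaling_conformable:
  fixes T :: ereal
  assumes "0 < \<alpha>" "0 < T"
  shows "measure_rescaling (source_measure \<alpha> T) (target_measure \<alpha> T)
    (\<lambda>t. t powr \<alpha>) (\<lambda>s. s powr (1 / \<alpha>)) \<alpha>"
proof -
  define I where "I = einterval 0 T"
  define J where "J = einterval 0 (ereal_rpow T \<alpha>)"
  have J: "(\<lambda>t. t powr \<alpha>) ` I = J" and I: "(\<lambda>s. s powr (1 / \<alpha>)) ` J = I"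
    using einterval_0_powr_image[OF assms] by (simp_all add: I_def J_def)
  have leb: "I \<in> sets lebesgue" "J \<in> sets lebesgue"
    by (auto simp: I_def J_def)
  have pos: "I \<subseteq> {0<..}" "J \<subseteq> {0<..}"
    by (auto simp: I_def J_def einterval_def)
  have \<phi>: "(\<lambda>t. t powr \<alpha>) \<in> lebesgue_on I \<rightarrow>\<^sub>M lebesgue_on J"
    using assms(1) leb pos J by (intro measurable_powr_lebesgue_on) auto
  have \<psi>: "(\<lambda>s. s powr (1 / \<alpha>)) \<in> lebesgue_on J \<rightarrow>\<^sub>M lebesgue_on I"
    using assms(1) leb pos I by (intro measurable_powr_lebesgue_on) auto
  have inv: "(s powr (1 / \<alpha>)) powr \<alpha> = s" "(s powr \<alpha>) powr (1 / \<alpha>) = s" if "0 < s" for s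
    using that assms(1) by (auto simp: powr_powr)
  have "distr (lebesgue_on J) (conformable_measure \<alpha> I) (\<lambda>s. s powr (1 / \<alpha>)) =
      density (conformable_measure \<alpha> I) (\<lambda>_. ennreal \<alpha>)" (is "?D = ?E")
  proof (rule measure_eqI)
    fix A assume "A \<in> sets ?D"
    then have A': "A \<in> sets (lebesgue_on I)"
      by (simp add: sets_conformable_measure)
    with leb have A: "A \<in> sets lebesgue" "A \<subseteq> I"
      by (auto simp: sets_restrict_space_iff)
    \<comment> \<open>Turns the pushforward of A into the measure of an image, which the
      substitution formula computes.\<close>
    have eq: "(\<lambda>s. s powr (1 / \<alpha>)) -` A \<inter> J = (\<lambda>t. t powr \<alpha>) ` A"
    proof (intro equalityI subsetI)
      fix s assume "s \<in> (\<lambda>s. s powr (1 / \<alpha>)) -` A \<inter> J"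
      then show "s \<in> (\<lambda>t. t powr \<alpha>) ` A"
        using pos inv(1)[of s] by (intro image_eqI[of _ _ "s powr (1 / \<alpha>)"]) auto
    next
      fix s assume "s \<in> (\<lambda>t. t powr \<alpha>) ` A"
      then show "s \<in> (\<lambda>s. s powr (1 / \<alpha>)) -` A \<inter> J"
        using pos A(2) J inv(2) by auto
    qed
    have meas: "(\<lambda>t. ennreal (t powr (\<alpha> - 1))) \<in> borel_measurable (lebesgue_on I)"
      by (intro measurable_restrict_space1 measurable_completion) simp
    have "emeasure ?D A = emeasure (lebesgue_on J) ((\<lambda>t. t powr \<alpha>) ` A)"
      using \<psi> A' eq by (subst emeasure_distr) (auto simp: sets_conformable_measure cong: measurable_cong_sets)
    also have "\<dots> = emeasure lebesgue ((\<lambda>t. t powr \<alpha>) ` A)"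
      using leb A(2) J by (intro emeasure_restrict_space) auto
    also have "\<dots> = (\<integral>\<^sup>+t. ennreal \<bar>\<alpha> * t powr (\<alpha> - 1)\<bar> \<partial>lebesgue_on A)"
      using A pos assms(1) by (intro emeasure_powr_image(2)) auto
    \<comment> \<open>Positivity of \<alpha> removes the absolute value. The indicator carries the
      integral from A through the whole line to I, where the density of the conformable measure is
      defined.\<close>
    also have "\<dots> = (\<integral>\<^sup>+t. ennreal \<alpha> * (ennreal (t powr (\<alpha> - 1)) * indicator A t) \<partial>lebesgue)"
      using A(1) assms(1)
      by (subst nn_integral_restrict_space) (auto intro!: nn_integral_cong simp: abs_mult ennreal_mult mult.assoc)
    also have "\<dots> = (\<integral>\<^sup>+t. ennreal \<alpha> * (ennreal (t powr (\<alpha> - 1)) * indicator A t) \<partial>lebesgue_on I)"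
      using leb(1) A(2)
      by (subst nn_integral_restrict_space) (auto intro!: nn_integral_cong simp: indicator_def)
    also have "\<dots> = ennreal \<alpha> * (\<integral>\<^sup>+t. ennreal (t powr (\<alpha> - 1)) * indicator A t \<partial>lebesgue_on I)"
      using meas A' by (intro nn_integral_cmult) auto
    also have "\<dots> = ennreal \<alpha> * emeasure (conformable_measure \<alpha> I) A"
      using meas A' by (simp add: conformable_measure_def emeasure_density)
    also have "\<dots> = emeasure ?E A"
      using A' by (simp add: emeasure_density_const sets_conformable_measure)
    finally show "emeasure ?D A = emeasure ?E A" .
  qed simp
  then show ?thesis
    unfolding I_def[symmetric] J_def[symmetric]
    using \<phi> \<psi> assms(1) pos(2) inv(1)
    by unfold_locales (auto simp: measurable_cong_sets[OF sets_conformable_measure refl]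
        measurable_cong_sets[OF refl sets_conformable_measure])
qed

text \<open>The operator U itself scales norms by \<open>\<alpha> powr (1 / p)\<close>, which is
  below 1. The statement therefore gives U as a linear isomorphism with this exact factor, and the
  isometry for the normalized operator. The conjunct on \<open>Lp_functions\<close> shows that U is
  composition for every representative, not just the chosen one.\<close>

theorem proposition2:
  fixes p \<alpha> :: real and T :: ereal
  assumes "1 \<le> p" and "0 < \<alpha>" and "\<alpha> < 1" and "0 < T"
  shows "conformable_Phi \<alpha> \<in> einterval 0 T \<rightarrow> einterval 0 (ereal_rpow T \<alpha>) \<and>
    (\<forall>f\<in>Lp_functions p (source_measure \<alpha> T).
       conformable_U_fun \<alpha> f \<in> Lp_functions p (target_measure \<alpha> T) \<and>
       conformable_U p \<alpha> T (Lp_class p (source_measure \<alpha> T) f) =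
         Lp_class p (target_measure \<alpha> T) (conformable_U_fun \<alpha> f)) \<and>
    Lp_linear_isomorphism p (source_measure \<alpha> T) (target_measure \<alpha> T) (conformable_U p \<alpha> T) \<and>
    (\<forall>F\<in>Lp_space p (source_measure \<alpha> T).
       Lp_norm p (target_measure \<alpha> T) (conformable_U p \<alpha> T F) =
         \<alpha> powr (1 / p) * Lp_norm p (source_measure \<alpha> T) F) \<and>
    Lp_isometric_isomorphism p (source_measure \<alpha> T) (target_measure \<alpha> T)
      (conformable_U_normalized p \<alpha> T)"
proof -
  interpret measure_rescaling "source_measure \<alpha> T" "target_measure \<alpha> T"
    "\<lambda>t. t powr \<alpha>" "\<lambda>s. s powr (1 / \<alpha>)" \<alpha>
    using assms by (intro measure_rescaling_conformable)
  \<comment> \<open>Both sides unfold to the same class of the composed representative, so the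
    results of the locale transfer directly.\<close>
  have U: "conformable_U p \<alpha> T = comp_class p"
    by (simp add: fun_eq_iff conformable_U_def conformable_U_fun_def comp_class_def)
  have V: "conformable_U_normalized p \<alpha> T = (\<lambda>F. Lp_scale p (target_measure \<alpha> T)
      (of_real (\<alpha> powr (- 1 / p))) (comp_class p F))"
    by (simp add: fun_eq_iff conformable_U_normalized_def U)
  have "conformable_Phi \<alpha> \<in> einterval 0 T \<rightarrow> einterval 0 (ereal_rpow T \<alpha>)"
    using einterval_0_powr_image(1)[of \<alpha> T] assms by (auto simp: conformable_Phi_def)
  then show ?thesis
    using assms(1) Lp_functions_comp comp_class_Lp_class Lp_norm_comp_class
      Lp_linear_isomorphism_comp_class[of p] Lp_isometric_isomorphism_comp_class[of p]
    by (simp add: U V conformable_U_fun_def)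
qed

end
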